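(* Let $a\ge b>0$ and let $s'=\sqrt{\frac{2b^2+ab}{2a^2+ab}}$. Then for every triangle in the circumcircle family with parameters $a,b$, and for every triangle in its image under the scaling $(x,y)\mapsto(s'x,y)$ (which is an excentral family), the internal angles $\theta_1,\theta_2,\theta_3$ satisfy $$\prod_{i=1}^3\cos\theta_i=\frac{ab}{2(a+b)^2}.$$
   Context: Circumcircle family with parameters $a,b$: the set of all (nondegenerate) triangles inscribed in the circle of radius $R=a+b$ centered at the origin whose three sides are tangent to the concentric ellipse $x^2/a^2+y^2/b^2=1$ (the caustic). (By Poncelet's porism, with this value of $R$, every point of the circle is a vertex of exactly one such triangle.) Confocal family: for an ellipse and a confocal ellipse inside it such that triangles inscribed in the outer one and circumscribed about the inner one exist, the set of all such triangles. Excentral family: the set of excentral triangles of the triangles in a confocal family, where the excentral triangle of a triangle $T$ is the triangle whose vertices are the excenters of $T$ (its sides pass through the vertices of $T$ perpendicularly to the internal angle bisectors). *)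

theory Defs
  imports "HOL-Analysis.Analysis"
begin

type_synonym point = "real \<times> real"

text \<open>
  Triangles are represented by labelled vertex triples. All families below are closed under
  permuting the labels.
\<close>
type_synonym tri = "point \<times> point \<times> point"

definition nondegenerate :: "tri \<Rightarrow> bool" where
  "nondegenerate = (\<lambda>(A, B, C). \<not> collinear {A, B, C})"

definition inscribed_in :: "tri \<Rightarrow> point set \<Rightarrow> bool" where
  "inscribed_in = (\<lambda>(A, B, C) S. A \<in> S \<and> B \<in> S \<and> C \<in> S)"

text \<open>
  The vector \<open>v\<close> is tangent to the curve \<open>S\<close> at \<open>P\<close> if it is the velocity at \<open>P\<close> of some motion
  inside \<open>S\<close>.
\<close>
definition tangent_vector :: "point set \<Rightarrow> point \<Rightarrow> point \<Rightarrow> bool" where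
  "tangent_vector S P v \<longleftrightarrow>
     (\<exists>\<gamma> :: real \<Rightarrow> point.
        \<gamma> 0 = P \<and> (\<forall>t. \<gamma> t \<in> S) \<and> (\<gamma> has_vector_derivative v) (at 0))"

definition tangent_line :: "point \<Rightarrow> point \<Rightarrow> point set \<Rightarrow> bool" where
  "tangent_line P Q S \<longleftrightarrow>
     P \<noteq> Q \<and> (\<exists>X \<in> affine hull {P, Q} \<inter> S. tangent_vector S X (Q - P))"

definition circumscribed_about :: "tri \<Rightarrow> point set \<Rightarrow> bool" where
  "circumscribed_about = (\<lambda>(A, B, C) S.
     tangent_line A B S \<and> tangent_line B C S \<and> tangent_line C A S)"

definition poncelet_triangles :: "point set \<Rightarrow> point set \<Rightarrow> tri set" where
  "poncelet_triangles S S' =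
     {T. nondegenerate T \<and> inscribed_in T S \<and> circumscribed_about T S'}"

definition circumcircle_family :: "real \<Rightarrow> real \<Rightarrow> tri set" where
  "circumcircle_family a b =
     poncelet_triangles (sphere (0, 0) (a + b)) {(x, y). x\<^sup>2 / a\<^sup>2 + y\<^sup>2 / b\<^sup>2 = 1}"

text \<open>
  The ellipse with foci \<open>F\<close>, \<open>G\<close> and semi-major axis \<open>m\<close>; it is a proper ellipse if and only if
  \<open>dist F G < 2 * m\<close>. Circles are the case \<open>F = G\<close>.
\<close>
definition focal_ellipse :: "point \<Rightarrow> point \<Rightarrow> real \<Rightarrow> point set" where
  "focal_ellipse F G m = {P. dist P F + dist P G = 2 * m}"

definition confocal_family :: "tri set \<Rightarrow> bool" where
  "confocal_family \<F> \<longleftrightarrow>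
     (\<exists>F G m n. dist F G < 2 * n \<and> n < m \<and>
        \<F> = poncelet_triangles (focal_ellipse F G m) (focal_ellipse F G n) \<and> \<F> \<noteq> {})"

text \<open>
  The external bisector of the angle \<open>Q P R\<close>: the line through \<open>P\<close> perpendicular to the internal
  bisector, whose direction is the sum of the unit vectors from \<open>P\<close> towards \<open>Q\<close> and \<open>R\<close>.
\<close>
definition external_bisector :: "point \<Rightarrow> point \<Rightarrow> point \<Rightarrow> point set" where
  "external_bisector Q P R = {X. (X - P) \<bullet> (sgn (Q - P) + sgn (R - P)) = 0}"

text \<open>The excenter opposite a vertex is where the external bisectors at the other two meet.\<close>
definition excentral_of :: "tri \<Rightarrow> tri \<Rightarrow> bool" where
  "excentral_of = (\<lambda>(A, B, C) (A', B', C').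
     A' \<in> external_bisector A B C \<inter> external_bisector B C A \<and>
     B' \<in> external_bisector B C A \<inter> external_bisector C A B \<and>
     C' \<in> external_bisector C A B \<inter> external_bisector A B C)"

definition excentral_family :: "tri set \<Rightarrow> bool" where
  "excentral_family \<E> \<longleftrightarrow> (\<exists>\<F>. confocal_family \<F> \<and> \<E> = {T'. \<exists>T\<in>\<F>. excentral_of T T'})"

definition scale_x :: "real \<Rightarrow> point \<Rightarrow> point" where
  "scale_x s = (\<lambda>(x, y). (s * x, y))"

definition scale_tri :: "real \<Rightarrow> tri \<Rightarrow> tri" where
  "scale_tri s = (\<lambda>(A, B, C). (scale_x s A, scale_x s B, scale_x s C))"

definition angle :: "point \<Rightarrow> point \<Rightarrow> point \<Rightarrow> real" where
  "angle Q P R = arccos (((Q - P) \<bullet> (R - P)) / (norm (Q - P) * norm (R - P)))"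

definition cos_product :: "tri \<Rightarrow> real" where
  "cos_product = (\<lambda>(A, B, C). cos (angle C A B) * cos (angle A B C) * cos (angle B C A))"

end

theory Submission
  imports Defs
begin

text \<open>
  Write \<open>R = a + b\<close>. Three ideas carry the proof.

  \<^bold>\<open>Tangency is conjugacy.\<close> For two points \<open>(x1, y1)\<close>, \<open>(x2, y2)\<close> of the circle of radius
  \<open>R\<close>, the tangency of their chord to the caustic amounts, up to a factor that vanishes only if the points
  coincide, to a relation linear in \<open>x1 x2\<close> and \<open>y1 y2\<close>, which for this value of \<open>R\<close> is
  \<open>x1 x2 / a + y1 y2 / b = - R\<close> (\<open>tangent_chord_conjugate\<close>). The three
  vertices of a triangle of the family are therefore pairwise conjugate for one fixed conic, and
  the elementary symmetric functions of their abscissas depend on one parameter \<open>k\<close> only: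
  they are \<open>- (a - b) k\<close>, \<open>- a (a + 2 b)\<close> and \<open>a\<^sup>2 R k\<close> (\<open>circumcircle_family_coordinates\<close>).

  \<^bold>\<open>The cosines.\<close> If \<open>u\<close>, \<open>v\<close>, \<open>w\<close> are the inner products of the two side vectors at the
  vertices, the squared sides are \<open>u + v\<close>, \<open>v + w\<close>, \<open>w + u\<close>, so that the product of the cosines is
  \<open>u v w / ((u + v) (v + w) (w + u))\<close>. After the scaling by \<open>s\<close> in the first coordinate the inner
  product at each vertex is still one fixed quadratic polynomial in the abscissa of that vertex.
  The quotient is thus a function of \<open>k\<close>, and for \<open>s = 1\<close> and \<open>s = s'\<close> it is the same constant
  (\<open>cos_product_identity_circle\<close>, \<open>cos_product_identity_scaled\<close>).

  \<^bold>\<open>Excentral triangles are polar duals.\<close> Let \<open>E\<close> have semi-axes \<open>p, q\<close> and let \<open>E'\<close>, with semi-axes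
  \<open>\<alpha>, \<beta>\<close>, be confocal with it. By the reflection property the tangent of \<open>E\<close> at a vertex of a
  Poncelet triangle is the external bisector there, so the excentral triangle consists of the poles of
  the sides with respect to \<open>E\<close> (\<open>excentral_iff_polar_dual\<close>). Polarity in \<open>E\<close> turns
  \<open>inscribed in E, circumscribed about E'\<close> into \<open>circumscribed about E, inscribed in E''\<close>, where \<open>E''\<close>
  has semi-axes \<open>p\<^sup>2 / \<alpha>\<close> and \<open>q\<^sup>2 / \<beta>\<close>; this is a bijection of Poncelet families
  (\<open>poncelet_triangles_polar_dual\<close>). For the scaled circumcircle family \<open>E\<close> is the scaled caustic,
  with semi-axes \<open>s a, b\<close>, and \<open>E''\<close> the scaled circle, with semi-axes \<open>s R, R\<close>. This forces
  \<open>\<alpha> = s a\<^sup>2 / R\<close> and \<open>\<beta> = b\<^sup>2 / R\<close>, and \<open>s = s'\<close> is the value for which \<open>E\<close> and \<open>E'\<close> are confocal.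
\<close>

section \<open>Plane geometry in coordinates\<close>

lemma collinear_iff_cross:
  fixes A B C :: point
  shows "collinear {A, B, C} \<longleftrightarrow>
    (fst B - fst A) * (snd C - snd A) = (fst C - fst A) * (snd B - snd A)"
proof -
  have *: "collinear {0, u, v} \<longleftrightarrow> fst u * snd v = fst v * snd u" for u v :: point
  proof
    assume "collinear {0, u, v}"
    then show "fst u * snd v = fst v * snd u"
      unfolding collinear_lemma by auto
  next
    assume eq: "fst u * snd v = fst v * snd u"
    show "collinear {0, u, v}"
    proof (cases "u = 0")
      case False
      then have "fst u \<noteq> 0 \<or> snd u \<noteq> 0" by (simp add: prod_eq_iff)
      then have "v = (fst v / fst u) *\<^sub>R u \<or> v = (snd v / snd u) *\<^sub>R u"
        using eq by (auto simp: prod_eq_iff field_simps)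
      then show ?thesis unfolding collinear_lemma by blast
    qed simp
  qed
  have "{A, B, C} = {B, A, C}" by auto
  then have "collinear {A, B, C} \<longleftrightarrow> collinear {0, B - A, C - A}"
    using collinear_3[of B A C] by simp
  then show ?thesis using * by (simp add: mult.commute)
qed

lemma distinct_if_not_collinear:
  assumes "\<not> collinear {A, B, C :: point}"
  shows "A \<noteq> B" "B \<noteq> C" "C \<noteq> A"
  using assms by (auto simp: insert_commute)

lemma both_orthogonal_imp_parallel:
  fixes u v d :: point
  assumes "d \<noteq> 0" and "u \<bullet> d = 0" and "v \<bullet> d = 0"
  shows "fst u * snd v = fst v * snd u"
proof -
  have "fst d * (fst u * snd v - fst v * snd u) = 0" "snd d * (fst u * snd v - fst v * snd u) = 0"
    using assms(2,3) unfolding inner_prod_def inner_real_def by algebra+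
  then show ?thesis using assms(1) by (auto simp: prod_eq_iff)
qed

lemma orthogonal_to_parallel:
  fixes f g z :: point
  assumes "f \<noteq> 0" and "fst f * snd g = fst g * snd f" and "f \<bullet> z = 0"
  shows "g \<bullet> z = 0"
proof -
  have "fst f * (g \<bullet> z) = 0" "snd f * (g \<bullet> z) = 0"
    using assms(2,3) unfolding inner_prod_def inner_real_def by algebra+
  then show ?thesis using assms(1) by (auto simp: prod_eq_iff)
qed

section \<open>Ellipses, tangents and polar duality\<close>

definition ellipse :: "real \<Rightarrow> real \<Rightarrow> point set" where
  "ellipse p q = {(x, y). x\<^sup>2 / p\<^sup>2 + y\<^sup>2 / q\<^sup>2 = 1}"

text \<open>
  The bilinear form of the ellipse with semi-axes \<open>p, q\<close>: the equation \<open>polar_form p q P X = 1\<close> in \<open>X\<close>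
  is the polar line of \<open>P\<close>, and the tangent at \<open>P\<close> if \<open>P\<close> lies on the ellipse.
\<close>
definition polar_form :: "real \<Rightarrow> real \<Rightarrow> point \<Rightarrow> point \<Rightarrow> real" where
  "polar_form p q P Q = fst P * fst Q / p\<^sup>2 + snd P * snd Q / q\<^sup>2"

lemma ellipse_iff: "P \<in> ellipse p q \<longleftrightarrow> polar_form p q P P = 1"
  by (cases P) (simp add: ellipse_def polar_form_def power2_eq_square)

lemma polar_form_commute: "polar_form p q P Q = polar_form p q Q P"
  by (simp add: polar_form_def mult.commute)

lemma polar_form_diff: "polar_form p q P (Q - R) = polar_form p q P Q - polar_form p q P R"
  by (simp add: polar_form_def algebra_simps diff_divide_distrib)

lemma polar_form_inner: "polar_form p q P Q = (fst P / p\<^sup>2, snd P / q\<^sup>2) \<bullet> Q"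
  by (simp add: polar_form_def inner_prod_def)

lemma polar_form_definite:
  assumes "p > 0" "q > 0" "P \<noteq> 0"
  shows "polar_form p q P P > 0"
proof -
  have "(fst P / p)\<^sup>2 + (snd P / q)\<^sup>2 > 0"
    using assms by (simp add: sum_power2_gt_zero_iff prod_eq_iff)
  then show ?thesis by (simp add: polar_form_def power2_eq_square)
qed

text \<open>
  Differentiating \<open>polar_form p q (\<gamma> t) (\<gamma> t) = 1\<close> at \<open>0\<close> gives one direction. For the other, the vector
  is a multiple of the semi-diameter conjugate to \<open>X\<close>, and a motion \<open>cos (k t) X + sin (k t) Y\<close>
  along conjugate semi-diameters \<open>X, Y\<close> has the required velocity.
\<close>
lemma tangent_vector_ellipse:
  assumes "p > 0" "q > 0" and X: "X \<in> ellipse p q"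
  shows "tangent_vector (ellipse p q) X v \<longleftrightarrow> polar_form p q X v = 0"
proof
  assume "tangent_vector (ellipse p q) X v"
  then obtain \<gamma> where g: "\<gamma> 0 = X" "\<And>t. \<gamma> t \<in> ellipse p q"
    "(\<gamma> has_vector_derivative v) (at 0)"
    unfolding tangent_vector_def by blast
  have d1: "((\<lambda>t. fst (\<gamma> t)) has_real_derivative fst v) (at 0)"
    and d2: "((\<lambda>t. snd (\<gamma> t)) has_real_derivative snd v) (at 0)"
    using has_derivative_fst[OF g(3)[unfolded has_vector_derivative_def]]
      has_derivative_snd[OF g(3)[unfolded has_vector_derivative_def]]
    by (simp_all add: has_real_derivative_iff_has_vector_derivative has_vector_derivative_def)
  have "((\<lambda>t. polar_form p q (\<gamma> t) (\<gamma> t)) has_real_derivative 2 * polar_form p q X v) (at 0)"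
    unfolding polar_form_def using assms
    by (auto intro!: derivative_eq_intros d1 d2 simp: g(1) field_simps power2_eq_square)
  moreover have "(\<lambda>t. polar_form p q (\<gamma> t) (\<gamma> t)) = (\<lambda>t. 1)"
    using g(2) by (simp add: ellipse_iff)
  ultimately show "polar_form p q X v = 0"
    using DERIV_unique[OF _ DERIV_const[of 1 "at 0"]] by force
next
  assume v: "polar_form p q X v = 0"
  let ?Y = "(- p / q * snd X, q / p * fst X)"
  have X1: "(fst X)\<^sup>2 / p\<^sup>2 + (snd X)\<^sup>2 / q\<^sup>2 = 1"
    using X by (simp add: ellipse_iff polar_form_def power2_eq_square)
  \<comment> \<open>\<open>?Y\<close> is the conjugate semi-diameter; \<open>k\<close> is the coordinate of \<open>v\<close> along it.\<close>
  define k where "k = (fst X * snd v - snd X * fst v) / (p * q)"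
  have e: "q\<^sup>2 * fst X * fst v + p\<^sup>2 * snd X * snd v = 0"
    "q\<^sup>2 * (fst X)\<^sup>2 + p\<^sup>2 * (snd X)\<^sup>2 = p\<^sup>2 * q\<^sup>2"
    using v X1 assms by (simp_all add: polar_form_def field_simps)
  have "p\<^sup>2 * (q\<^sup>2 * fst v) = p\<^sup>2 * (snd X * (snd X * fst v - fst X * snd v))"
    "q\<^sup>2 * (p\<^sup>2 * snd v) = q\<^sup>2 * (fst X * (fst X * snd v - snd X * fst v))"
    using e by algebra+
  then have qp: "q\<^sup>2 * fst v = snd X * (snd X * fst v - fst X * snd v)"
    "p\<^sup>2 * snd v = fst X * (fst X * snd v - snd X * fst v)"
    using assms by (subst (asm) mult_left_cancel; simp)+
  have "k * (- p / q * snd X) = snd X * (snd X * fst v - fst X * snd v) / q\<^sup>2"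
    "k * (q / p * fst X) = fst X * (fst X * snd v - snd X * fst v) / p\<^sup>2"
    using assms by (simp_all add: k_def field_simps power2_eq_square)
  then have kY: "v = k *\<^sub>R ?Y"
    unfolding qp[symmetric] using assms by (simp add: prod_eq_iff)
  define \<gamma> where "\<gamma> = (\<lambda>t. cos (k * t) *\<^sub>R X + sin (k * t) *\<^sub>R ?Y)"
  have "\<gamma> 0 = X" by (simp add: \<gamma>_def zero_prod_def[symmetric])
  moreover have "\<gamma> t \<in> ellipse p q" for t
  proof -
    have "polar_form p q (c *\<^sub>R X + d *\<^sub>R ?Y) (c *\<^sub>R X + d *\<^sub>R ?Y)
      = (c\<^sup>2 + d\<^sup>2) * ((fst X)\<^sup>2 / p\<^sup>2 + (snd X)\<^sup>2 / q\<^sup>2)" for c d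
      using assms by (simp add: polar_form_def field_simps power2_eq_square)
    then show ?thesis using X1 by (simp add: ellipse_iff \<gamma>_def)
  qed
  moreover have "(\<gamma> has_vector_derivative v) (at 0)"
    unfolding \<gamma>_def kY
    by (rule derivative_eq_intros refl | simp)+
  ultimately show "tangent_vector (ellipse p q) X v"
    unfolding tangent_vector_def by blast
qed

text \<open>
  The tangent at \<open>X\<close> is the polar line of \<open>X\<close>. In this form tangency of a line is the existence of a
  pole on the ellipse, which is what polar duality transports.
\<close>
lemma tangent_line_ellipse:
  assumes "p > 0" "q > 0"
  shows "tangent_line P Q (ellipse p q) \<longleftrightarrow>
    P \<noteq> Q \<and> (\<exists>X \<in> ellipse p q. polar_form p q X P = 1 \<and> polar_form p q X Q = 1)"
proof (cases "P = Q")
  case False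
  have "X \<in> affine hull {P, Q} \<and> polar_form p q X (Q - P) = 0 \<longleftrightarrow>
    polar_form p q X P = 1 \<and> polar_form p q X Q = 1" if X: "X \<in> ellipse p q" for X
  proof
    assume *: "X \<in> affine hull {P, Q} \<and> polar_form p q X (Q - P) = 0"
    then obtain u v where uv: "u + v = 1" "X = u *\<^sub>R P + v *\<^sub>R Q"
      unfolding affine_hull_2 by blast
    have eq: "polar_form p q X P = polar_form p q X Q" using * by (simp add: polar_form_diff)
    have "polar_form p q X (u *\<^sub>R P + v *\<^sub>R Q) = u * polar_form p q X P + v * polar_form p q X Q"
      by (simp add: polar_form_inner inner_add_right)
    also have "\<dots> = (u + v) * polar_form p q X P" by (simp add: eq distrib_right)
    finally show "polar_form p q X P = 1 \<and> polar_form p q X Q = 1"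
      using X uv eq by (simp add: ellipse_iff)
  next
    assume *: "polar_form p q X P = 1 \<and> polar_form p q X Q = 1"
    let ?n = "(fst X / p\<^sup>2, snd X / q\<^sup>2)"
    have n: "?n \<noteq> 0"
      using * assms by (auto simp: polar_form_def zero_prod_def)
    have "fst (Q - P) * snd (X - P) = fst (X - P) * snd (Q - P)"
      by (rule both_orthogonal_imp_parallel[OF n])
        (use * X in \<open>simp_all add: inner_commute[of _ ?n] polar_form_inner[symmetric]
          polar_form_diff ellipse_iff\<close>)
    then have "collinear {P, Q, X}" by (simp add: collinear_iff_cross)
    then have "X \<in> affine hull {P, Q}"
      using False collinear_3_affine_hull by blast
    then show "X \<in> affine hull {P, Q} \<and> polar_form p q X (Q - P) = 0"
      using * by (simp add: polar_form_diff)
  qed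
  then show ?thesis
    unfolding tangent_line_def using tangent_vector_ellipse[OF assms] False by blast
qed (simp add: tangent_line_def)

text \<open>
  The vertices of \<open>T'\<close> are the poles of the opposite sides of \<open>T\<close>, with labels matched: \<open>A'\<close> belongs to
  the side \<open>B C\<close>, as for the excenter opposite \<open>A\<close>.
\<close>
definition polar_dual :: "real \<Rightarrow> real \<Rightarrow> tri \<Rightarrow> tri \<Rightarrow> bool" where
  "polar_dual p q = (\<lambda>(A, B, C) (A', B', C').
     polar_form p q A' B = 1 \<and> polar_form p q A' C = 1 \<and>
     polar_form p q B' C = 1 \<and> polar_form p q B' A = 1 \<and>
     polar_form p q C' A = 1 \<and> polar_form p q C' B = 1)"

lemma polar_dual_sym: "polar_dual p q T T' \<Longrightarrow> polar_dual p q T' T"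
  by (auto simp: polar_dual_def polar_form_commute split: prod.splits)

text \<open>
  The affine functions \<open>l X + m Y - 1\<close> of the three polars vanish at two vertices of \<open>T\<close> each. The
  matrix of their values at the vertices is hence diagonal, and its determinant is, up to sign, the
  product of the determinants of \<open>T\<close> and of the polars. No diagonal entry is \<open>0\<close>, for an affine
  function that vanishes at three noncollinear points is \<open>0\<close>, and these have value \<open>- 1\<close> at the origin.
\<close>
lemma polar_dual_nondegenerate:
  assumes "polar_dual p q T T'" and "nondegenerate T" and "p > 0" "q > 0"
  shows "nondegenerate T'"
proof -
  obtain A B C A' B' C' where T: "T = (A, B, C)" "T' = (A', B', C')" by (metis prod.exhaust)
  obtain x1 y1 x2 y2 x3 y3 where A: "A = (x1, y1)" "B = (x2, y2)" "C = (x3, y3)"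
    by (metis prod.exhaust)
  define l1 m1 l2 m2 l3 m3 where l: "l1 = fst A' / p\<^sup>2" "m1 = snd A' / q\<^sup>2"
    "l2 = fst B' / p\<^sup>2" "m2 = snd B' / q\<^sup>2" "l3 = fst C' / p\<^sup>2" "m3 = snd C' / q\<^sup>2"
  have d: "l1 * x2 + m1 * y2 = 1" "l1 * x3 + m1 * y3 = 1" "l2 * x1 + m2 * y1 = 1"
    "l2 * x3 + m2 * y3 = 1" "l3 * x1 + m3 * y1 = 1" "l3 * x2 + m3 * y2 = 1"
    using assms(1) by (simp_all add: polar_dual_def polar_form_def T A l)
  define det where "det = (x2 - x1) * (y3 - y1) - (x3 - x1) * (y2 - y1)"
  have det: "det \<noteq> 0" using assms(2) by (simp add: nondegenerate_def T A collinear_iff_cross det_def)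
  show ?thesis
  proof (rule ccontr)
    assume "\<not> nondegenerate T'"
    then have "(fst B' - fst A') * (snd C' - snd A') = (fst C' - fst A') * (snd B' - snd A')"
      by (simp add: nondegenerate_def T collinear_iff_cross)
    then have "(l2 - l1) * (m3 - m1) = (l3 - l1) * (m2 - m1)"
      using assms(3,4) by (simp add: l diff_divide_distrib[symmetric])
    then have "(l1 * x1 + m1 * y1 - 1) * (l2 * x2 + m2 * y2 - 1) * (l3 * x3 + m3 * y3 - 1) = 0"
      using d unfolding det_def by algebra
    moreover have "l1 * x1 + m1 * y1 \<noteq> 1" "l2 * x2 + m2 * y2 \<noteq> 1" "l3 * x3 + m3 * y3 \<noteq> 1"
      using d det unfolding det_def by algebra+
    ultimately show False by simp
  qed
qed

text \<open>
  The dual triangle here is the triangle of contact points.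
\<close>
lemma poncelet_triangles_ellipse:
  assumes "p > 0" "q > 0"
  shows "T \<in> poncelet_triangles S (ellipse p q) \<longleftrightarrow>
    nondegenerate T \<and> inscribed_in T S \<and>
    (\<exists>U. inscribed_in U (ellipse p q) \<and> polar_dual p q T U)"
proof -
  obtain A B C where T: "T = (A, B, C)" by (metis prod.exhaust)
  have "circumscribed_about T (ellipse p q) \<longleftrightarrow>
    (\<exists>U. inscribed_in U (ellipse p q) \<and> polar_dual p q T U)" if "nondegenerate T"
  proof -
    have "A \<noteq> B" "B \<noteq> C" "C \<noteq> A"
      using that distinct_if_not_collinear by (simp_all add: nondegenerate_def T)
    then show ?thesis
      unfolding T circumscribed_about_def inscribed_in_def polar_dual_def
      by (simp add: tangent_line_ellipse[OF assms] del: split_paired_Ex) fast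
  qed
  then show ?thesis unfolding poncelet_triangles_def by blast
qed

text \<open>
  A line off the origin has only one equation of the form \<open>l x + m y = 1\<close>. Comparing the equations
  given by its poles for the two ellipses shows that one pole is a diagonal linear image of the other,
  and this map sends \<open>ellipse (p\<^sup>2 / \<alpha>) (q\<^sup>2 / \<beta>)\<close> to \<open>ellipse \<alpha> \<beta>\<close>.
\<close>
lemma tangent_line_iff_pole:
  assumes "p > 0" "q > 0" "\<alpha> > 0" "\<beta> > 0" "P \<noteq> Q"
    and Z: "polar_form p q Z P = 1" "polar_form p q Z Q = 1"
  shows "tangent_line P Q (ellipse \<alpha> \<beta>) \<longleftrightarrow> Z \<in> ellipse (p\<^sup>2 / \<alpha>) (q\<^sup>2 / \<beta>)"
proof -
  let ?X = "(\<alpha>\<^sup>2 / p\<^sup>2 * fst Z, \<beta>\<^sup>2 / q\<^sup>2 * snd Z)"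
  have XZ: "polar_form \<alpha> \<beta> ?X Y = polar_form p q Z Y" for Y
    using assms by (simp add: polar_form_def)
  have Xon: "?X \<in> ellipse \<alpha> \<beta> \<longleftrightarrow> Z \<in> ellipse (p\<^sup>2 / \<alpha>) (q\<^sup>2 / \<beta>)"
    using assms by (simp add: ellipse_iff polar_form_def field_simps power2_eq_square)
  have uniq: "X = ?X" if X: "polar_form \<alpha> \<beta> X P = 1" "polar_form \<alpha> \<beta> X Q = 1" for X
  proof -
    obtain x1 y1 x2 y2 where P: "P = (x1, y1)" "Q = (x2, y2)" by (metis prod.exhaust)
    define l m l' m' where l: "l = fst X / \<alpha>\<^sup>2" "m = snd X / \<beta>\<^sup>2" "l' = fst Z / p\<^sup>2" "m' = snd Z / q\<^sup>2"
    have e: "l * x1 + m * y1 = 1" "l * x2 + m * y2 = 1" "l' * x1 + m' * y1 = 1" "l' * x2 + m' * y2 = 1"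
      using X Z by (simp_all add: polar_form_def P l)
    \<comment> \<open>If \<open>P\<close> and \<open>Q\<close> were proportional, the common value \<open>1\<close> would force \<open>P = Q\<close>.\<close>
    have "x1 * y2 \<noteq> x2 * y1"
    proof
      assume "x1 * y2 = x2 * y1"
      then have "x1 = x2" "y1 = y2" using e by algebra+
      then show False using assms P by simp
    qed
    then have "l = l'" "m = m'" using e by algebra+
    then show ?thesis using assms by (simp add: l prod_eq_iff field_simps)
  qed
  show ?thesis
    unfolding tangent_line_ellipse[OF assms(3,4)] using Xon XZ Z uniq assms(5) by metis
qed

lemma circumscribed_iff_polar_dual_inscribed:
  assumes "p > 0" "q > 0" "\<alpha> > 0" "\<beta> > 0" and "nondegenerate T" and "polar_dual p q T T'"
  shows "circumscribed_about T (ellipse \<alpha> \<beta>) \<longleftrightarrow> inscribed_in T' (ellipse (p\<^sup>2 / \<alpha>) (q\<^sup>2 / \<beta>))"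
proof -
  obtain A B C A' B' C' where T: "T = (A, B, C)" "T' = (A', B', C')" by (metis prod.exhaust)
  have "A \<noteq> B" "B \<noteq> C" "C \<noteq> A"
    using assms(5) distinct_if_not_collinear by (simp_all add: nondegenerate_def T)
  moreover have "polar_form p q A' B = 1 \<and> polar_form p q A' C = 1 \<and>
     polar_form p q B' C = 1 \<and> polar_form p q B' A = 1 \<and>
     polar_form p q C' A = 1 \<and> polar_form p q C' B = 1"
    using assms(6) by (simp add: T polar_dual_def)
  ultimately have "tangent_line A B (ellipse \<alpha> \<beta>) \<longleftrightarrow> C' \<in> ellipse (p\<^sup>2 / \<alpha>) (q\<^sup>2 / \<beta>)"
    "tangent_line B C (ellipse \<alpha> \<beta>) \<longleftrightarrow> A' \<in> ellipse (p\<^sup>2 / \<alpha>) (q\<^sup>2 / \<beta>)"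
    "tangent_line C A (ellipse \<alpha> \<beta>) \<longleftrightarrow> B' \<in> ellipse (p\<^sup>2 / \<alpha>) (q\<^sup>2 / \<beta>)"
    by (simp_all add: tangent_line_iff_pole[OF assms(1-4)])
  then show ?thesis by (auto simp: T circumscribed_about_def inscribed_in_def)
qed

lemma poncelet_triangles_polar_dual:
  assumes "p > 0" "q > 0" "\<alpha> > 0" "\<beta> > 0"
  shows "{T'. \<exists>T \<in> poncelet_triangles (ellipse p q) (ellipse \<alpha> \<beta>). polar_dual p q T T'} =
    poncelet_triangles (ellipse (p\<^sup>2 / \<alpha>) (q\<^sup>2 / \<beta>)) (ellipse p q)" (is "?L = ?R")
proof (intro set_eqI)
  fix T'
  have "T' \<in> ?L \<longleftrightarrow> (\<exists>T. nondegenerate T \<and> inscribed_in T (ellipse p q) \<and>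
      circumscribed_about T (ellipse \<alpha> \<beta>) \<and> polar_dual p q T T')"
    by (auto simp: poncelet_triangles_def)
  also have "\<dots> \<longleftrightarrow> (\<exists>T. nondegenerate T' \<and> inscribed_in T (ellipse p q) \<and>
      inscribed_in T' (ellipse (p\<^sup>2 / \<alpha>) (q\<^sup>2 / \<beta>)) \<and> polar_dual p q T' T)"
    using circumscribed_iff_polar_dual_inscribed[OF assms] polar_dual_sym
      polar_dual_nondegenerate[OF _ _ assms(1,2)] by blast
  also have "\<dots> \<longleftrightarrow> T' \<in> ?R"
    unfolding poncelet_triangles_ellipse[OF assms(1,2)] by blast
  finally show "T' \<in> ?L \<longleftrightarrow> T' \<in> ?R" .
qed

section \<open>Confocal ellipses and excentral triangles\<close>

text \<open>
  Joachimsthal's integral of the elliptic billiard: for a chord from \<open>P\<close> that touches a confocal ellipse,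
  the component of its unit direction along the gradient at \<open>P\<close> has the same absolute value, whichever of
  the tangents from \<open>P\<close> is taken. The line through \<open>P\<close> with direction \<open>(d, e)\<close> touches \<open>ellipse \<alpha> \<beta>\<close> if
  \<open>\<alpha>\<^sup>2 e\<^sup>2 + \<beta>\<^sup>2 d\<^sup>2 = c\<^sup>2\<close> with \<open>c\<close> the cross product of \<open>P\<close> and \<open>(d, e)\<close>, and Lagrange's identity
  rewrites the difference of this condition and its analogue for \<open>p, q\<close>.
\<close>
lemma joachimsthal:
  assumes "p > 0" "q > 0" "\<alpha> > 0" "\<beta> > 0" and conf: "p\<^sup>2 - \<alpha>\<^sup>2 = q\<^sup>2 - \<beta>\<^sup>2"
    and P: "P \<in> ellipse p q" and t: "tangent_line P Q (ellipse \<alpha> \<beta>)"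
  shows "(p * q * polar_form p q P (Q - P))\<^sup>2 = (p\<^sup>2 - \<alpha>\<^sup>2) * (norm (Q - P))\<^sup>2"
proof -
  obtain X where X: "X \<in> ellipse \<alpha> \<beta>" "polar_form \<alpha> \<beta> X P = 1" "polar_form \<alpha> \<beta> X Q = 1"
    using t tangent_line_ellipse[OF assms(3,4)] by blast
  obtain x y where xy: "P = (x, y)" by (metis prod.exhaust)
  obtain d e where de: "Q - P = (d, e)" by (metis prod.exhaust)
  define l m where l: "l = fst X / \<alpha>\<^sup>2" "m = snd X / \<beta>\<^sup>2"
  have lm: "polar_form \<alpha> \<beta> X Y = l * fst Y + m * snd Y" for Y by (simp add: polar_form_def l)
  have "polar_form \<alpha> \<beta> X (d, e) = 0" using X by (simp add: polar_form_diff flip: de)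
  then have h: "l * d + m * e = 0" "l * x + m * y = 1"
    using X(2) unfolding lm xy by simp_all
  have h2: "\<alpha>\<^sup>2 * l\<^sup>2 + \<beta>\<^sup>2 * m\<^sup>2 = 1"
    using X(1) assms by (simp add: ellipse_iff polar_form_def l power2_eq_square)
  have h3: "q\<^sup>2 * x\<^sup>2 + p\<^sup>2 * y\<^sup>2 = p\<^sup>2 * q\<^sup>2"
    using P assms by (simp add: ellipse_iff polar_form_def xy field_simps power2_eq_square)
  define c where "c = x * e - y * d"
  have dl: "d = - c * m" "e = c * l" using h unfolding c_def by algebra+
  have "\<alpha>\<^sup>2 * e\<^sup>2 + \<beta>\<^sup>2 * d\<^sup>2 = c\<^sup>2 * (\<alpha>\<^sup>2 * l\<^sup>2 + \<beta>\<^sup>2 * m\<^sup>2)"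
    unfolding dl by (simp add: algebra_simps power2_eq_square)
  then have tang: "\<alpha>\<^sup>2 * e\<^sup>2 + \<beta>\<^sup>2 * d\<^sup>2 = c\<^sup>2" using h2 by simp
  have pf: "p * q * polar_form p q P (Q - P) = (q\<^sup>2 * x * d + p\<^sup>2 * y * e) / (p * q)"
    unfolding de unfolding xy using assms by (simp add: polar_form_def field_simps power2_eq_square)
  have "(q\<^sup>2 * x * d + p\<^sup>2 * y * e)\<^sup>2 = (q\<^sup>2 * x\<^sup>2 + p\<^sup>2 * y\<^sup>2) * (q\<^sup>2 * d\<^sup>2 + p\<^sup>2 * e\<^sup>2) - p\<^sup>2 * q\<^sup>2 * c\<^sup>2"
    unfolding c_def by (simp add: algebra_simps power2_eq_square)
  also have "\<dots> = p\<^sup>2 * q\<^sup>2 * (q\<^sup>2 * d\<^sup>2 + p\<^sup>2 * e\<^sup>2 - (\<alpha>\<^sup>2 * e\<^sup>2 + \<beta>\<^sup>2 * d\<^sup>2))"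
    unfolding h3 tang by (simp add: algebra_simps)
  also have "q\<^sup>2 * d\<^sup>2 + p\<^sup>2 * e\<^sup>2 - (\<alpha>\<^sup>2 * e\<^sup>2 + \<beta>\<^sup>2 * d\<^sup>2) = (p\<^sup>2 - \<alpha>\<^sup>2) * (d\<^sup>2 + e\<^sup>2)"
    using conf by algebra
  also have "d\<^sup>2 + e\<^sup>2 = (norm (Q - P))\<^sup>2" by (simp add: de norm_prod_def)
  finally show ?thesis
    unfolding pf using assms(1,2) by (simp add: power_divide power_mult_distrib)
qed

text \<open>
  Strict convexity: the ellipse lies on the inner side of each of its tangents.
\<close>
lemma polar_form_less_one:
  assumes "p > 0" "q > 0" "P \<in> ellipse p q" "Q \<in> ellipse p q" "P \<noteq> Q"
  shows "polar_form p q P Q < 1"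
proof -
  have "polar_form p q (P - Q) (P - Q)
    = polar_form p q P P + polar_form p q Q Q - 2 * polar_form p q P Q"
    by (simp add: polar_form_def algebra_simps add_divide_distrib diff_divide_distrib)
  moreover have "polar_form p q (P - Q) (P - Q) > 0"
    by (rule polar_form_definite) (use assms in auto)
  ultimately show ?thesis using assms by (simp add: ellipse_iff)
qed

lemma tangent_line_sym:
  "tangent_line P Q (ellipse p q) \<Longrightarrow> p > 0 \<Longrightarrow> q > 0 \<Longrightarrow> tangent_line Q P (ellipse p q)"
  by (auto simp: tangent_line_ellipse)

text \<open>
  The unit vectors \<open>u, w\<close> towards \<open>Q, R\<close> have equal components along the normal \<open>n\<close> at \<open>P\<close>: equal
  absolute values by Joachimsthal's integral, and the same sign because \<open>Q\<close> and \<open>R\<close> lie on the inner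
  side of the tangent. So \<open>u - w\<close> is orthogonal to \<open>n\<close>; it is orthogonal to \<open>u + w\<close> too, as \<open>u\<close> and
  \<open>w\<close> have the same length. Hence the internal bisector \<open>u + w\<close> is parallel to \<open>n\<close>.
\<close>
lemma external_bisector_eq_tangent:
  assumes pos: "p > 0" "q > 0" "\<alpha> > 0" "\<beta> > 0" and conf: "p\<^sup>2 - \<alpha>\<^sup>2 = q\<^sup>2 - \<beta>\<^sup>2"
    and on: "P \<in> ellipse p q" "Q \<in> ellipse p q" "R \<in> ellipse p q"
    and tan: "tangent_line Q P (ellipse \<alpha> \<beta>)" "tangent_line P R (ellipse \<alpha> \<beta>)"
    and nc: "\<not> collinear {P, Q, R}"
  shows "external_bisector Q P R = {X. polar_form p q P X = 1}"
proof -
  define n where "n = (fst P / p\<^sup>2, snd P / q\<^sup>2)"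
  define u w where "u = sgn (Q - P)" and "w = sgn (R - P)"
  note dist = distinct_if_not_collinear[OF nc]
  have unit: "(p * q * (n \<bullet> sgn (Z - P)))\<^sup>2 = p\<^sup>2 - \<alpha>\<^sup>2" "n \<bullet> sgn (Z - P) < 0"
    if Z: "Z \<in> ellipse p q" "tangent_line P Z (ellipse \<alpha> \<beta>)" "P \<noteq> Z" for Z
  proof -
    have s: "n \<bullet> sgn (Z - P) = polar_form p q P (Z - P) / norm (Z - P)"
      by (simp add: n_def polar_form_inner sgn_div_norm divide_inverse_commute)
    have N: "norm (Z - P) > 0" using Z by simp
    show "(p * q * (n \<bullet> sgn (Z - P)))\<^sup>2 = p\<^sup>2 - \<alpha>\<^sup>2"
      using joachimsthal[OF pos conf on(1) Z(2)] N
      by (simp add: s power_divide)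
    have "polar_form p q P (Z - P) < 0"
      using polar_form_less_one[OF pos(1,2) on(1) Z(1,3)] on(1)
      by (simp add: polar_form_diff ellipse_iff)
    then show "n \<bullet> sgn (Z - P) < 0" using N by (simp add: s divide_neg_pos)
  qed
  have u: "(p * q * (n \<bullet> u))\<^sup>2 = p\<^sup>2 - \<alpha>\<^sup>2" "n \<bullet> u < 0"
    and w: "(p * q * (n \<bullet> w))\<^sup>2 = p\<^sup>2 - \<alpha>\<^sup>2" "n \<bullet> w < 0"
    using unit[of Q] unit[of R] on tan dist tangent_line_sym[OF tan(1) pos(3,4)]
    by (auto simp: u_def w_def)
  have "(n \<bullet> u)\<^sup>2 = (n \<bullet> w)\<^sup>2" using u(1)[folded w(1)] pos by (simp add: power_mult_distrib)
  then have nuw: "n \<bullet> u = n \<bullet> w" using u(2) w(2) by (simp add: power2_eq_iff)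
  have "u \<noteq> w"
  proof
    assume "u = w"
    have "R - P = norm (R - P) *\<^sub>R w" using dist by (simp add: w_def sgn_div_norm)
    also have "\<dots> = (norm (R - P) / norm (Q - P)) *\<^sub>R (Q - P)"
      by (simp add: u_def sgn_div_norm divide_inverse flip: \<open>u = w\<close>)
    finally have "collinear {0, Q - P, R - P}" unfolding collinear_lemma by blast
    then show False using nc collinear_3[of Q P R] by (simp add: insert_commute)
  qed
  then have e: "u - w \<noteq> 0" by simp
  have ne: "n \<bullet> (u - w) = 0" using nuw by (simp add: inner_diff_right)
  have "norm u = 1" "norm w = 1" using dist by (auto simp: u_def w_def norm_sgn)
  then have "u \<bullet> u = 1" "w \<bullet> w = 1" by (simp_all add: dot_square_norm)
  then have fe: "(u + w) \<bullet> (u - w) = 0"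
    by (simp add: inner_add_left inner_diff_right inner_commute[of w u])
  have "n \<bullet> (u + w) < 0" using u(2) w(2) by (simp add: inner_add_right)
  then have nz: "n \<noteq> 0" "u + w \<noteq> 0" by (metis inner_zero_left less_irrefl, metis inner_zero_right less_irrefl)
  have par: "fst n * snd (u + w) = fst (u + w) * snd n"
    by (rule both_orthogonal_imp_parallel[OF e ne fe])
  have "(X - P) \<bullet> (u + w) = 0 \<longleftrightarrow> polar_form p q P X = 1" for X
  proof -
    have "(X - P) \<bullet> (u + w) = 0 \<longleftrightarrow> n \<bullet> (X - P) = 0"
      using orthogonal_to_parallel[OF nz(1) par, of "X - P"]
        orthogonal_to_parallel[OF nz(2) par[symmetric], of "X - P"]
      by (auto simp: inner_commute)
    also have "\<dots> \<longleftrightarrow> polar_form p q P X = 1"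
      using on(1) by (simp add: n_def polar_form_inner[symmetric] polar_form_diff ellipse_iff)
    finally show ?thesis .
  qed
  then show ?thesis by (simp add: external_bisector_def u_def w_def)
qed

lemma excentral_iff_polar_dual:
  assumes pos: "p > 0" "q > 0" "\<alpha> > 0" "\<beta> > 0" and conf: "p\<^sup>2 - \<alpha>\<^sup>2 = q\<^sup>2 - \<beta>\<^sup>2"
    and T: "T \<in> poncelet_triangles (ellipse p q) (ellipse \<alpha> \<beta>)"
  shows "excentral_of T T' \<longleftrightarrow> polar_dual p q T T'"
proof -
  obtain A B C A' B' C' where TT: "T = (A, B, C)" "T' = (A', B', C')" by (metis prod.exhaust)
  have on: "A \<in> ellipse p q" "B \<in> ellipse p q" "C \<in> ellipse p q"
    and tan: "tangent_line A B (ellipse \<alpha> \<beta>)" "tangent_line B C (ellipse \<alpha> \<beta>)"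
      "tangent_line C A (ellipse \<alpha> \<beta>)" and nc: "\<not> collinear {A, B, C}"
    using T by (simp_all add: TT poncelet_triangles_def nondegenerate_def inscribed_in_def
      circumscribed_about_def)
  have "external_bisector A B C = {X. polar_form p q B X = 1}"
    "external_bisector B C A = {X. polar_form p q C X = 1}"
    "external_bisector C A B = {X. polar_form p q A X = 1}"
    using external_bisector_eq_tangent[OF pos conf] on tan nc by (simp_all add: insert_commute)
  then show ?thesis
    by (auto simp: TT excentral_of_def polar_dual_def polar_form_commute)
qed

text \<open>
  If \<open>d, e\<close> are the focal distances, \<open>d\<^sup>2 - e\<^sup>2 = 4 c x\<close>; together with \<open>d + e = 2 m\<close> this gives
  \<open>d = m + c x / m\<close> and \<open>e = m - c x / m\<close>, and the square of either is the Cartesian equation.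
\<close>
lemma focal_ellipse_eq:
  assumes "0 \<le> c" "c < m"
  shows "focal_ellipse (- c, 0) (c, 0) m = ellipse m (sqrt (m\<^sup>2 - c\<^sup>2))"
proof -
  have m: "m > 0" and mc: "m\<^sup>2 - c\<^sup>2 > 0" using assms by (auto simp: power_strict_mono)
  have "dist (x, y) (- c, 0) + dist (x, y) (c, 0) = 2 * m \<longleftrightarrow> x\<^sup>2 / m\<^sup>2 + y\<^sup>2 / (m\<^sup>2 - c\<^sup>2) = 1"
    (is "?d + ?e = _ \<longleftrightarrow> ?E") for x y
  proof -
    have d: "?d\<^sup>2 = (x + c)\<^sup>2 + y\<^sup>2" and e: "?e\<^sup>2 = (x - c)\<^sup>2 + y\<^sup>2"
      by (simp_all add: dist_prod_def dist_real_def)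
    have E: "?E \<longleftrightarrow> (x + c)\<^sup>2 + y\<^sup>2 = (m + c * x / m)\<^sup>2"
      using m mc by (simp add: field_simps power2_eq_square) algebra
    have E': "?E \<longleftrightarrow> (x - c)\<^sup>2 + y\<^sup>2 = (m - c * x / m)\<^sup>2"
      using m mc by (simp add: field_simps power2_eq_square) algebra
    show ?thesis
    proof
      assume s: "?d + ?e = 2 * m"
      have "(?d - ?e) * (?d + ?e) = 4 * c * x" using d e by (simp add: algebra_simps power2_eq_square)
      then have "(?d - ?e) * (2 * m) = 4 * c * x" by (simp only: s)
      then have "(?d - ?e) * m = 2 * c * x" by algebra
      then have "?d - ?e = 2 * c * x / m" using m by (simp add: field_simps)
      then have "?d = m + c * x / m" using s by simp
      then show ?E using d E by simp
    next
      assume h: ?E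
      \<comment> \<open>The square roots need \<open>m + c x / m\<close> and \<open>m - c x / m\<close> to be nonnegative.\<close>
      have "x\<^sup>2 / m\<^sup>2 \<le> 1" using h mc by (smt (verit) divide_nonneg_pos zero_le_power2)
      then have "\<bar>x\<bar> \<le> m" using m by (simp add: abs_le_square_iff[symmetric])
      then have "\<bar>c * x\<bar> \<le> m * m" using assms by (simp add: abs_mult mult_mono)
      then have "\<bar>c * x / m\<bar> \<le> m" using m by (simp add: field_simps)
      then have nn: "m + c * x / m \<ge> 0" "m - c * x / m \<ge> 0" by linarith+
      have "?d = m + c * x / m" "?e = m - c * x / m"
        using h d e E E' nn by (metis power2_eq_imp_eq zero_le_dist)+
      then show "?d + ?e = 2 * m" by simp
    qed
  qed
  then show ?thesis using mc by (auto simp: focal_ellipse_def ellipse_def)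
qed

section \<open>Scaling\<close>

lemma polar_form_scale:
  assumes "s > 0"
  shows "polar_form (s * p) q (scale_x s P) (scale_x s Q) = polar_form p q P Q"
  using assms by (simp add: polar_form_def scale_x_def case_prod_beta power2_eq_square)

lemma scale_tri_inverse:
  assumes "s > 0"
  shows "scale_tri s (scale_tri (1 / s) T) = T"
  using assms by (auto simp: scale_tri_def scale_x_def split: prod.splits)

lemma scale_tri_poncelet_subset:
  assumes "s > 0" "p > 0" "q > 0" and T: "T \<in> poncelet_triangles (ellipse m n) (ellipse p q)"
  shows "scale_tri s T \<in> poncelet_triangles (ellipse (s * m) n) (ellipse (s * p) q)"
proof -
  have sp: "s * p > 0" using assms by simp
  have ins: "inscribed_in (scale_tri s U) (ellipse (s * k) l)" if "inscribed_in U (ellipse k l)" for U k l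
    using that by (auto simp: inscribed_in_def scale_tri_def ellipse_iff polar_form_scale[OF assms(1)])
  have nd: "nondegenerate (scale_tri s T)" if "nondegenerate T"
    using that assms(1)
    by (auto simp: nondegenerate_def scale_tri_def collinear_iff_cross scale_x_def
      right_diff_distrib[symmetric] mult.assoc)
  have du: "polar_dual (s * p) q (scale_tri s T) (scale_tri s U)" if "polar_dual p q T U" for U
    using that unfolding polar_dual_def scale_tri_def case_prod_beta fst_conv snd_conv
    by (simp only: polar_form_scale[OF assms(1)])
  show ?thesis
    using T ins nd du
    unfolding poncelet_triangles_ellipse[OF assms(2,3)] poncelet_triangles_ellipse[OF sp assms(3)]
    by blast
qed

lemma scale_tri_poncelet:
  assumes "s > 0" "p > 0" "q > 0"
  shows "scale_tri s ` poncelet_triangles (ellipse m n) (ellipse p q) =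
    poncelet_triangles (ellipse (s * m) n) (ellipse (s * p) q)"
proof (intro equalityI subsetI)
  fix T assume "T \<in> poncelet_triangles (ellipse (s * m) n) (ellipse (s * p) q)"
  then have "scale_tri (1 / s) T \<in> poncelet_triangles (ellipse m n) (ellipse p q)"
    using scale_tri_poncelet_subset[of "1 / s" "s * p" q T "s * m" n] assms by simp
  then show "T \<in> scale_tri s ` poncelet_triangles (ellipse m n) (ellipse p q)"
    using scale_tri_inverse[OF assms(1), of T] by (metis image_eqI)
qed (use scale_tri_poncelet_subset[OF assms] in auto)

section \<open>The circumcircle family\<close>

lemma sphere_eq_ellipse:
  assumes "r > 0"
  shows "sphere (0, 0) r = ellipse r r"
proof -
  have "dist (0, 0) P = r \<longleftrightarrow> (fst P)\<^sup>2 + (snd P)\<^sup>2 = r\<^sup>2" for P :: point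
  proof -
    have "dist (0, 0) P = sqrt ((fst P)\<^sup>2 + (snd P)\<^sup>2)" by (simp add: dist_prod_def dist_real_def)
    then show ?thesis using assms by (metis abs_of_pos real_sqrt_abs real_sqrt_eq_iff)
  qed
  then show ?thesis
    using assms by (auto simp: ellipse_def field_simps)
qed

lemma circumcircle_family_eq:
  assumes "a > 0" "b > 0"
  shows "circumcircle_family a b = poncelet_triangles (ellipse (a + b) (a + b)) (ellipse a b)"
  using assms by (simp add: circumcircle_family_def sphere_eq_ellipse) (simp add: ellipse_def)

text \<open>
  With \<open>g = x1 x2 + y1 y2\<close>, the quantities that enter the tangency condition of the chord,
  \<open>a\<^sup>2 (y2 - y1)\<^sup>2 + b\<^sup>2 (x2 - x1)\<^sup>2 = (x1 y2 - x2 y1)\<^sup>2\<close>, all contain the factor \<open>R\<^sup>2 - g\<close>, half the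
  squared length of the chord. Cancelling it leaves a condition linear in \<open>x1 x2\<close> and \<open>y1 y2\<close>, and
  \<open>R = a + b\<close> turns its coefficients into multiples of \<open>b\<close>, \<open>a\<close> and \<open>a b R\<close>.
\<close>
lemma tangent_chord_conjugate:
  assumes "a > 0" "b > 0" and P: "x1\<^sup>2 + y1\<^sup>2 = (a + b)\<^sup>2" and Q: "x2\<^sup>2 + y2\<^sup>2 = (a + b)\<^sup>2"
    and t: "tangent_line (x1, y1) (x2, y2) (ellipse a b)"
  shows "b * x1 * x2 + a * y1 * y2 = - a * b * (a + b)"
proof -
  obtain X where X: "X \<in> ellipse a b" "polar_form a b X (x1, y1) = 1" "polar_form a b X (x2, y2) = 1"
    and ne: "(x1, y1) \<noteq> (x2, y2)"
    using t tangent_line_ellipse[OF assms(1,2)] by blast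
  define l m where l: "l = fst X / a\<^sup>2" "m = snd X / b\<^sup>2"
  have h: "l * x1 + m * y1 = 1" "l * x2 + m * y2 = 1"
    using X(2,3) by (simp_all add: polar_form_def l)
  have h2: "a\<^sup>2 * l\<^sup>2 + b\<^sup>2 * m\<^sup>2 = 1"
    using X(1) assms by (simp add: ellipse_iff polar_form_def l power2_eq_square)
  define D where "D = x1 * y2 - x2 * y1"
  have dl: "x2 - x1 = - D * m" "y2 - y1 = D * l" using h unfolding D_def by algebra+
  have "a\<^sup>2 * (y2 - y1)\<^sup>2 + b\<^sup>2 * (x2 - x1)\<^sup>2 = D\<^sup>2 * (a\<^sup>2 * l\<^sup>2 + b\<^sup>2 * m\<^sup>2)"
    unfolding dl by (simp add: algebra_simps power2_eq_square)
  then have tang: "a\<^sup>2 * (y2 - y1)\<^sup>2 + b\<^sup>2 * (x2 - x1)\<^sup>2 = D\<^sup>2" using h2 by simp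
  define R where "R = a + b"
  define g k where "g = x1 * x2 + y1 * y2" and "k = x1 * x2 - y1 * y2"
  have P': "x1\<^sup>2 + y1\<^sup>2 = R\<^sup>2" and Q': "x2\<^sup>2 + y2\<^sup>2 = R\<^sup>2" using P Q by (simp_all add: R_def)
  have D: "D\<^sup>2 = (R\<^sup>2 - g) * (R\<^sup>2 + g)" using P' Q' unfolding D_def g_def by algebra
  have dy: "R\<^sup>2 * (y2 - y1)\<^sup>2 = (R\<^sup>2 - g) * (R\<^sup>2 + k)" using P' Q' unfolding k_def g_def by algebra
  have dx: "R\<^sup>2 * (x2 - x1)\<^sup>2 = (R\<^sup>2 - g) * (R\<^sup>2 - k)" using P' Q' unfolding k_def g_def by algebra
  have "(R\<^sup>2 - g) * (a\<^sup>2 * (R\<^sup>2 + k) + b\<^sup>2 * (R\<^sup>2 - k) - R\<^sup>2 * (R\<^sup>2 + g)) = 0"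
    using D dy dx tang by algebra
  moreover have "R\<^sup>2 - g \<noteq> 0"
  proof
    assume "R\<^sup>2 - g = 0"
    then have "R\<^sup>2 * (x2 - x1)\<^sup>2 = 0" "R\<^sup>2 * (y2 - y1)\<^sup>2 = 0" using dx dy by simp_all
    then show False using ne assms by (simp add: R_def)
  qed
  ultimately have "a\<^sup>2 * (R\<^sup>2 + k) + b\<^sup>2 * (R\<^sup>2 - k) - R\<^sup>2 * (R\<^sup>2 + g) = 0" by simp
  then have "R * (b * x1 * x2 + a * y1 * y2 + a * b * R) = 0"
    unfolding k_def g_def R_def by algebra
  then show ?thesis using assms by (simp add: R_def)
qed

text \<open>
  The side \<open>P2 P3\<close> lies on the line \<open>b x1 x + a y1 y = - a b R\<close>. Its midpoint is the foot of the
  perpendicular from the centre of the circle, which gives \<open>x2 + x3\<close> as a rational function of \<open>P1\<close>; conjugacy of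
  \<open>P2\<close> and \<open>P3\<close> gives \<open>x2 x3\<close>. The denominators \<open>J\<close> and \<open>K\<close> are positive, and the claims become
  polynomial identities modulo the equation of the circle.
\<close>
lemma conjugate_triangle_symmetric_functions:
  fixes a b :: real
  assumes ab: "a > 0" "b > 0" and R: "R = a + b"
    and c1: "x1\<^sup>2 + y1\<^sup>2 = R\<^sup>2" and c2: "x2\<^sup>2 + y2\<^sup>2 = R\<^sup>2" and c3: "x3\<^sup>2 + y3\<^sup>2 = R\<^sup>2"
    and d12: "b * x1 * x2 + a * y1 * y2 = - a * b * R"
    and d23: "b * x2 * x3 + a * y2 * y3 = - a * b * R"
    and d31: "b * x3 * x1 + a * y3 * y1 = - a * b * R"
    and ne: "(x2, y2) \<noteq> (x3, y3)"
  shows "x1 * x2 + x2 * x3 + x3 * x1 = - a * (a + 2 * b)"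
    and "a\<^sup>2 * R * (x1 + x2 + x3) = - (a - b) * (x1 * x2 * x3)"
proof -
  define J K \<sigma> where "J = b * x1\<^sup>2 + a * y1\<^sup>2" and "K = b\<^sup>2 * x1\<^sup>2 + a\<^sup>2 * y1\<^sup>2" and "\<sigma> = x2 + x3"
  have R0: "R > 0" using ab R by simp
  then have "x1 \<noteq> 0 \<or> y1 \<noteq> 0" using c1 by auto
  then have J0: "J > 0" and K0: "K > 0"
    unfolding J_def K_def using ab by (auto simp: add_pos_nonneg add_nonneg_pos)
  have KJ: "K = R * (J - a * b * R)" unfolding K_def J_def using c1 R by algebra
  \<comment> \<open>Both \<open>P2 + P3\<close> and the normal \<open>(b x1, a y1)\<close> of the side are orthogonal to \<open>P2 - P3\<close>.\<close>
  have s: "a * y1 * (x2 + x3) = b * x1 * (y2 + y3)"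
  proof -
    have "(x2 + x3) * (x2 - x3) + (y2 + y3) * (y2 - y3) = 0" using c2 c3 by algebra
    moreover have "b * x1 * (x2 - x3) + a * y1 * (y2 - y3) = 0" using d12 d31 by algebra
    ultimately show ?thesis
      using both_orthogonal_imp_parallel[of "(x2 - x3, y2 - y3)" "(x2 + x3, y2 + y3)" "(b * x1, a * y1)"] ne
      by (simp add: prod_eq_iff mult_ac)
  qed
  have sK: "\<sigma> * K = - 2 * a * b\<^sup>2 * R * x1"
    using s d12 d31 unfolding \<sigma>_def K_def by algebra
  have "b * (J * (x2 * x3)) = b * (- a\<^sup>2 * R * y1\<^sup>2 - a\<^sup>2 * b * R\<^sup>2 - a * b * R * x1 * \<sigma>)"
    using d12 d23 d31 unfolding \<sigma>_def J_def by algebra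
  then have p: "J * (x2 * x3) = - a\<^sup>2 * R * y1\<^sup>2 - a\<^sup>2 * b * R\<^sup>2 - a * b * R * x1 * \<sigma>"
    using ab by simp
  have "J * R * (x1 * \<sigma> + x2 * x3) = x1 * (\<sigma> * K) - R * (a\<^sup>2 * R * (y1\<^sup>2 + b * R))"
    using p KJ by algebra
  also have "\<dots> = J * R * (- a * (a + 2 * b))"
    unfolding sK J_def using c1 R by algebra
  finally have e2: "x1 * \<sigma> + x2 * x3 = - a * (a + 2 * b)" using J0 R0 by (subst (asm) mult_left_cancel) auto
  then show "x1 * x2 + x2 * x3 + x3 * x1 = - a * (a + 2 * b)" unfolding \<sigma>_def by algebra
  have "K * (a\<^sup>2 * R * (x1 + \<sigma>)) = K * (- (a - b) * (x1 * (x2 * x3)))"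
  proof -
    have q: "x2 * x3 = - a * (a + 2 * b) - x1 * \<sigma>" using e2 by simp
    have "K * (a\<^sup>2 * R * (x1 + \<sigma>)) = a\<^sup>2 * R * (K * x1 + \<sigma> * K)" by (simp add: algebra_simps)
    also have "\<dots> = - (a - b) * (x1 * (- a * (a + 2 * b) * K - x1 * (\<sigma> * K)))"
      unfolding sK unfolding K_def using c1 R by algebra
    also have "\<dots> = K * (- (a - b) * (x1 * (x2 * x3)))" unfolding q by (simp add: algebra_simps)
    finally show ?thesis .
  qed
  then have "a\<^sup>2 * R * (x1 + \<sigma>) = - (a - b) * (x1 * (x2 * x3))"
    using K0 by (subst (asm) mult_left_cancel) auto
  then show "a\<^sup>2 * R * (x1 + x2 + x3) = - (a - b) * (x1 * x2 * x3)"
    by (simp add: \<sigma>_def algebra_simps)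
qed

section \<open>The product of the cosines\<close>

lemma cos_angle:
  "cos (angle Q P R) = ((Q - P) \<bullet> (R - P)) / (norm (Q - P) * norm (R - P))"
proof -
  have "\<bar>((Q - P) \<bullet> (R - P)) / (norm (Q - P) * norm (R - P))\<bar> \<le> 1"
    using Cauchy_Schwarz_ineq2[of "Q - P" "R - P"]
    by (cases "Q = P \<or> R = P") (auto simp: divide_le_eq_1)
  then show ?thesis unfolding angle_def by (intro cos_arccos) linarith+
qed

text \<open>
  By polarization the squared sides are the sums of the inner products at their end points.
\<close>
lemma cos_product_inner:
  assumes "u = (B - A) \<bullet> (C - A)" "v = (C - B) \<bullet> (A - B)" "w = (A - C) \<bullet> (B - C)"
  shows "cos_product (A, B, C) = u * v * w / ((u + v) * (v + w) * (w + u))"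
proof -
  have n: "u + v = (norm (B - A))\<^sup>2" "v + w = (norm (C - B))\<^sup>2" "w + u = (norm (A - C))\<^sup>2"
    unfolding assms power2_norm_eq_inner by (simp_all add: inner_diff_left inner_diff_right inner_commute)
  show ?thesis
    unfolding n by (simp add: cos_product_def cos_angle norm_minus_commute[of A B]
      norm_minus_commute[of B C] norm_minus_commute[of C A] inner_commute[of "C - A"]
      inner_commute[of "A - B"] inner_commute[of "B - C"]
      assms(1,2,3) power2_eq_square mult_ac)
qed

lemma quadratic_at_roots:
  fixes \<alpha> \<beta> \<gamma> x1 x2 x3 :: real
  defines "f \<equiv> \<lambda>x. \<alpha> * x\<^sup>2 + \<beta> * x + \<gamma>"
  assumes e1: "x1 + x2 + x3 = e1" and e2: "x1 * x2 + x2 * x3 + x3 * x1 = e2" and e3: "x1 * x2 * x3 = e3"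
  shows "f x1 + f x2 + f x3 = \<alpha> * (e1\<^sup>2 - 2 * e2) + \<beta> * e1 + 3 * \<gamma>"
    and "f x1 * f x2 + f x2 * f x3 + f x3 * f x1 = \<alpha>\<^sup>2 * (e2\<^sup>2 - 2 * e1 * e3) + \<alpha> * \<beta> * (e1 * e2 - 3 * e3)
      + 2 * \<alpha> * \<gamma> * (e1\<^sup>2 - 2 * e2) + \<beta>\<^sup>2 * e2 + 2 * \<beta> * \<gamma> * e1 + 3 * \<gamma>\<^sup>2"
    and "f x1 * f x2 * f x3 = \<alpha>^3 * e3\<^sup>2 + \<alpha>\<^sup>2 * \<beta> * e2 * e3 + \<alpha>\<^sup>2 * \<gamma> * (e2\<^sup>2 - 2 * e1 * e3)
      + \<alpha> * \<beta>\<^sup>2 * e1 * e3 + \<alpha> * \<beta> * \<gamma> * (e1 * e2 - 3 * e3) + \<alpha> * \<gamma>\<^sup>2 * (e1\<^sup>2 - 2 * e2)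
      + \<beta>^3 * e3 + \<beta>\<^sup>2 * \<gamma> * e2 + \<beta> * \<gamma>\<^sup>2 * e1 + \<gamma>^3"
  unfolding f_def e1[symmetric] e2[symmetric] e3[symmetric]
  by (simp_all add: algebra_simps power2_eq_square power3_eq_cube)

text \<open>
  Here \<open>f x\<close> is, up to a constant factor, the inner product of the sides at the vertex with abscissa \<open>x\<close>
  of a triangle of the circumcircle family. Since \<open>(u + v) (v + w) (w + u)\<close> equals
  \<open>(u + v + w) (u v + v w + w u) - u v w\<close>, both sides of the claim are polynomials in \<open>a\<close>, \<open>b\<close>, \<open>k\<close>.
\<close>
lemma cos_product_identity_circle:
  fixes a b k :: real
  defines "\<alpha> \<equiv> a - b" and "\<beta> \<equiv> (a - b)\<^sup>2 * k" and "\<gamma> \<equiv> a * b * (a + 2 * b)"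
  defines "f \<equiv> \<lambda>x. \<alpha> * x\<^sup>2 + \<beta> * x + \<gamma>"
  assumes "x1 + x2 + x3 = - (a - b) * k" "x1 * x2 + x2 * x3 + x3 * x1 = - a * (a + 2 * b)"
    "x1 * x2 * x3 = a\<^sup>2 * (a + b) * k"
  shows "2 * (a + b)\<^sup>2 * (f x1 * f x2 * f x3) = a * b * ((f x1 + f x2) * (f x2 + f x3) * (f x3 + f x1))"
proof -
  have "(f x1 + f x2) * (f x2 + f x3) * (f x3 + f x1) =
    (f x1 + f x2 + f x3) * (f x1 * f x2 + f x2 * f x3 + f x3 * f x1) - f x1 * f x2 * f x3"
    by (simp add: algebra_simps)
  then show ?thesis
    unfolding f_def quadratic_at_roots[OF assms(5-7)]
    unfolding \<alpha>_def \<beta>_def \<gamma>_def by algebra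
qed

text \<open>
  The same for the inner products after the scaling by \<open>s'\<close>, again up to a constant factor.
\<close>
lemma cos_product_identity_scaled:
  fixes a b k :: real
  defines "\<alpha> \<equiv> - (a + 2 * b) * (a - b)" and "\<beta> \<equiv> - b * (a - b)\<^sup>2 * k" and "\<gamma> \<equiv> (a * (a + 2 * b))\<^sup>2"
  defines "f \<equiv> \<lambda>x. \<alpha> * x\<^sup>2 + \<beta> * x + \<gamma>"
  assumes "x1 + x2 + x3 = - (a - b) * k" "x1 * x2 + x2 * x3 + x3 * x1 = - a * (a + 2 * b)"
    "x1 * x2 * x3 = a\<^sup>2 * (a + b) * k"
  shows "2 * (a + b)\<^sup>2 * (f x1 * f x2 * f x3) = a * b * ((f x1 + f x2) * (f x2 + f x3) * (f x3 + f x1))"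
proof -
  have "(f x1 + f x2) * (f x2 + f x3) * (f x3 + f x1) =
    (f x1 + f x2 + f x3) * (f x1 * f x2 + f x2 * f x3 + f x3 * f x1) - f x1 * f x2 * f x3"
    by (simp add: algebra_simps)
  then show ?thesis
    unfolding f_def quadratic_at_roots[OF assms(5-7)]
    unfolding \<alpha>_def \<beta>_def \<gamma>_def by algebra
qed

text \<open>
  The sum of the abscissas and the sum of their pairwise products eliminate \<open>x2\<close> and \<open>x3\<close> from
  \<open>(x2 - x1) (x3 - x1)\<close>; conjugacy turns each product of ordinates into a product of abscissas, and
  the circle does so for \<open>y1\<^sup>2\<close>. Here \<open>t\<close> is the square of the scaling factor.
\<close>
lemma inner_at_vertex:
  fixes a b t :: real
  assumes ab: "a > 0" "b > 0"
    and c1: "x1\<^sup>2 + y1\<^sup>2 = (a + b)\<^sup>2"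
    and d12: "b * x1 * x2 + a * y1 * y2 = - a * b * (a + b)"
    and d23: "b * x2 * x3 + a * y2 * y3 = - a * b * (a + b)"
    and d31: "b * x3 * x1 + a * y3 * y1 = - a * b * (a + b)"
    and e1: "x1 + x2 + x3 = e1"
    and e2: "x1 * x2 + x2 * x3 + x3 * x1 = - a * (a + 2 * b)"
  shows "a * (t * ((x2 - x1) * (x3 - x1)) + (y2 - y1) * (y3 - y1)) =
    (3 * t * a - (a + 2 * b)) * x1\<^sup>2 + 2 * (b - t * a) * e1 * x1
      + a * (a + 2 * b) * (a + 2 * b - t * a)"
proof -
  have X: "(x2 - x1) * (x3 - x1) = 3 * x1\<^sup>2 - 2 * e1 * x1 - a * (a + 2 * b)"
    using e2 unfolding e1[symmetric] by (simp add: algebra_simps power2_eq_square)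
  have "a * ((y2 - y1) * (y3 - y1)) =
    - (a + 2 * b) * x1\<^sup>2 + 2 * b * e1 * x1 + a * (a + 2 * b)\<^sup>2"
    using c1 d12 d23 d31 e1 e2 by algebra
  then show ?thesis unfolding distrib_left X by algebra
qed

lemma cos_product_if_proportional:
  assumes "nondegenerate (A, B, C)" and "c > 0"
    and "(B - A) \<bullet> (C - A) = g * u" "(C - B) \<bullet> (A - B) = g * v" "(A - C) \<bullet> (B - C) = g * w"
    and "c * (u * v * w) = d * ((u + v) * (v + w) * (w + u))"
  shows "cos_product (A, B, C) = d / c"
proof -
  have "A \<noteq> B" "B \<noteq> C" "C \<noteq> A"
    using assms(1) distinct_if_not_collinear by (simp_all add: nondegenerate_def)
  moreover have "g * u + g * v = (norm (B - A))\<^sup>2" "g * v + g * w = (norm (C - B))\<^sup>2"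
    "g * w + g * u = (norm (A - C))\<^sup>2"
    unfolding assms(3-5)[symmetric] power2_norm_eq_inner
    by (simp_all add: inner_diff_left inner_diff_right inner_commute)
  ultimately have nz: "(g * u + g * v) * (g * v + g * w) * (g * w + g * u) \<noteq> 0" by simp
  have "c * (g * u * (g * v) * (g * w)) = d * ((g * u + g * v) * (g * v + g * w) * (g * w + g * u))"
    using assms(6) by algebra
  then show ?thesis
    using nz assms(2) by (simp add: cos_product_inner[OF assms(3-5)[symmetric]] field_simps)
qed

text \<open>
  The parameter \<open>k\<close> is read off from the product of the abscissas, because for \<open>a = b\<close> their sum is \<open>0\<close>
  and does not determine it.
\<close>
lemma circumcircle_family_coordinates:
  assumes ab: "a > 0" "b > 0" and T: "T \<in> circumcircle_family a b"
  obtains x1 y1 x2 y2 x3 y3 k where "T = ((x1, y1), (x2, y2), (x3, y3))"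
    and "x1\<^sup>2 + y1\<^sup>2 = (a + b)\<^sup>2" "x2\<^sup>2 + y2\<^sup>2 = (a + b)\<^sup>2" "x3\<^sup>2 + y3\<^sup>2 = (a + b)\<^sup>2"
    and "b * x1 * x2 + a * y1 * y2 = - a * b * (a + b)"
      "b * x2 * x3 + a * y2 * y3 = - a * b * (a + b)"
      "b * x3 * x1 + a * y3 * y1 = - a * b * (a + b)"
    and "x1 + x2 + x3 = - (a - b) * k" "x1 * x2 + x2 * x3 + x3 * x1 = - a * (a + 2 * b)"
      "x1 * x2 * x3 = a\<^sup>2 * (a + b) * k"
proof -
  obtain x1 y1 x2 y2 x3 y3 where TT: "T = ((x1, y1), (x2, y2), (x3, y3))" by (metis prod.exhaust)
  have T': "nondegenerate T" "inscribed_in T (ellipse (a + b) (a + b))"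
    "circumscribed_about T (ellipse a b)"
    using T ab by (simp_all add: circumcircle_family_eq poncelet_triangles_def)
  have c: "x1\<^sup>2 + y1\<^sup>2 = (a + b)\<^sup>2" "x2\<^sup>2 + y2\<^sup>2 = (a + b)\<^sup>2" "x3\<^sup>2 + y3\<^sup>2 = (a + b)\<^sup>2"
    using T'(2) ab by (simp_all add: TT inscribed_in_def ellipse_def add_divide_distrib[symmetric])
  have ne: "(x2, y2) \<noteq> (x3, y3)"
    using T'(1) distinct_if_not_collinear(2) by (simp only: TT nondegenerate_def split) blast
  have d: "b * x1 * x2 + a * y1 * y2 = - a * b * (a + b)"
    "b * x2 * x3 + a * y2 * y3 = - a * b * (a + b)"
    "b * x3 * x1 + a * y3 * y1 = - a * b * (a + b)"
    using T'(3) tangent_chord_conjugate[OF ab] c by (simp_all add: TT circumscribed_about_def)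
  define k where "k = x1 * x2 * x3 / (a\<^sup>2 * (a + b))"
  note sf = conjugate_triangle_symmetric_functions[OF ab refl c d ne]
  have R: "a\<^sup>2 * (a + b) > 0" using ab by simp
  have e3: "x1 * x2 * x3 = a\<^sup>2 * (a + b) * k" using R ab by (simp add: k_def add_eq_0_iff)
  have "a\<^sup>2 * (a + b) * (x1 + x2 + x3) = a\<^sup>2 * (a + b) * (- (a - b) * k)"
    using sf(2) unfolding e3 by algebra
  then have "x1 + x2 + x3 = - (a - b) * k" using R by (subst (asm) mult_left_cancel) auto
  then show ?thesis using that TT c d sf(1) e3 by blast
qed

lemma scale_tri_one: "scale_tri 1 T = T"
  by (auto simp: scale_tri_def scale_x_def split: prod.splits)

lemma cos_product_scaled_circumcircle_family:
  assumes ab: "a > 0" "b > 0" and T: "T \<in> circumcircle_family a b" and s: "s > 0"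
    and cs: "s = 1 \<or> s\<^sup>2 = b * (a + 2 * b) / (a * (b + 2 * a))"
  shows "cos_product (scale_tri s T) = a * b / (2 * (a + b)\<^sup>2)"
proof -
  obtain x1 y1 x2 y2 x3 y3 k where TT: "T = ((x1, y1), (x2, y2), (x3, y3))"
    and c: "x1\<^sup>2 + y1\<^sup>2 = (a + b)\<^sup>2" "x2\<^sup>2 + y2\<^sup>2 = (a + b)\<^sup>2" "x3\<^sup>2 + y3\<^sup>2 = (a + b)\<^sup>2"
    and d: "b * x1 * x2 + a * y1 * y2 = - a * b * (a + b)"
      "b * x2 * x3 + a * y2 * y3 = - a * b * (a + b)"
      "b * x3 * x1 + a * y3 * y1 = - a * b * (a + b)"
    and e: "x1 + x2 + x3 = - (a - b) * k" "x1 * x2 + x2 * x3 + x3 * x1 = - a * (a + 2 * b)"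
      "x1 * x2 * x3 = a\<^sup>2 * (a + b) * k"
    using circumcircle_family_coordinates[OF ab T] by metis
  have e': "x2 + x3 + x1 = - (a - b) * k" "x3 + x1 + x2 = - (a - b) * k"
    "x2 * x3 + x3 * x1 + x1 * x2 = - a * (a + 2 * b)" "x3 * x1 + x1 * x2 + x2 * x3 = - a * (a + 2 * b)"
    using e by simp_all
  define f where "f = (\<lambda>x. (3 * s\<^sup>2 * a - (a + 2 * b)) * x\<^sup>2 + 2 * (b - s\<^sup>2 * a) * (- (a - b) * k) * x
      + a * (a + 2 * b) * (a + 2 * b - s\<^sup>2 * a))"
  have "scale_tri s T \<in> poncelet_triangles (ellipse (s * (a + b)) (a + b)) (ellipse (s * a) b)"
    using T scale_tri_poncelet_subset[OF s ab] by (simp add: circumcircle_family_eq ab)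
  then have nd: "nondegenerate ((s * x1, y1), (s * x2, y2), (s * x3, y3))"
    by (simp add: poncelet_triangles_def TT scale_tri_def scale_x_def)
  have i: "((s * u', v') - (s * u, v)) \<bullet> ((s * u'', v'') - (s * u, v)) =
    s\<^sup>2 * ((u' - u) * (u'' - u)) + (v' - v) * (v'' - v)" for u v u' v' u'' v''
    by (simp add: algebra_simps power2_eq_square)
  have N: "a * (s\<^sup>2 * ((x2 - x1) * (x3 - x1)) + (y2 - y1) * (y3 - y1)) = f x1"
    "a * (s\<^sup>2 * ((x3 - x2) * (x1 - x2)) + (y3 - y2) * (y1 - y2)) = f x2"
    "a * (s\<^sup>2 * ((x1 - x3) * (x2 - x3)) + (y1 - y3) * (y2 - y3)) = f x3"
    unfolding f_def
    by (rule inner_at_vertex[OF ab c(1) d e(1,2)] inner_at_vertex[OF ab c(2) d(2,3,1) e'(1,3)]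
      inner_at_vertex[OF ab c(3) d(3,1,2) e'(2,4)])+
  obtain g h where h: "\<And>x. f x = g * h x" "2 * (a + b)\<^sup>2 * (h x1 * h x2 * h x3) =
    a * b * ((h x1 + h x2) * (h x2 + h x3) * (h x3 + h x1))"
  proof (cases "s = 1")
    case True
    have "f x = 2 * ((a - b) * x\<^sup>2 + ((a - b)\<^sup>2 * k) * x + a * b * (a + 2 * b))" for x
      by (simp add: f_def True algebra_simps power2_eq_square)
    then show ?thesis using that[OF _ cos_product_identity_circle[OF e], of 2] by blast
  next
    case False
    then have "s\<^sup>2 = b * (a + 2 * b) / (a * (b + 2 * a))" using cs by blast
    then have "s\<^sup>2 * (a * (b + 2 * a)) = b * (a + 2 * b)" using ab by (simp only:) simp
    then have "(b + 2 * a) * f x = 2 * (- (a + 2 * b) * (a - b) * x\<^sup>2 + (- b * (a - b)\<^sup>2 * k) * x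
      + (a * (a + 2 * b))\<^sup>2)" (is "_ = 2 * ?h x") for x
      unfolding f_def by algebra
    moreover have "f x = 2 / (b + 2 * a) * y" if "(b + 2 * a) * f x = 2 * y" for x y
      using that ab by (simp add: field_simps)
    ultimately have "f x = 2 / (b + 2 * a) * ?h x" for x by blast
    then show ?thesis using that[OF _ cos_product_identity_scaled[OF e], of "2 / (b + 2 * a)"] by blast
  qed
  have fin: "u = g / a * h x" if "a * u = f x" for u x
    using that ab by (simp add: h(1) field_simps)
  have "cos_product ((s * x1, y1), (s * x2, y2), (s * x3, y3)) = a * b / (2 * (a + b)\<^sup>2)"
  proof (rule cos_product_if_proportional[OF nd, where g = "g / a"])
    show "2 * (a + b)\<^sup>2 > 0" using ab by simp
    show "2 * (a + b)\<^sup>2 * (h x1 * h x2 * h x3) =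
      a * b * ((h x1 + h x2) * (h x2 + h x3) * (h x3 + h x1))" by (rule h(2))
  qed (simp_all only: i N[THEN fin])
  then show ?thesis by (simp add: TT scale_tri_def scale_x_def)
qed

section \<open>The scaled family is excentral\<close>

text \<open>
  The witness is the isosceles triangle with apex \<open>(a + b, 0)\<close>; its base touches the caustic at \<open>(- a, 0)\<close>.
\<close>
lemma circumcircle_family_nonempty:
  assumes ab: "a > 0" "b > 0"
  shows "circumcircle_family a b \<noteq> {}"
proof -
  define h where "h = sqrt (b\<^sup>2 + 2 * a * b)"
  define z where "z = b\<^sup>2 * (2 * a + b) / ((a + b) * h)"
  have h: "h > 0" "h\<^sup>2 = b\<^sup>2 + 2 * a * b" using ab by (auto simp: h_def add_pos_pos)
  let ?T = "((a + b, 0), (- a, h), (- a, - h))"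
  let ?U = "((- a, 0), (a\<^sup>2 / (a + b), - z), (a\<^sup>2 / (a + b), z))"
  have R: "a + b > 0" using ab by simp
  have zh: "z * h / b\<^sup>2 = (2 * a + b) / (a + b)"
    using h(1) ab by (simp add: z_def)
  have zz: "z\<^sup>2 / b\<^sup>2 = b * (2 * a + b) / (a + b)\<^sup>2"
  proof -
    have "z\<^sup>2 / b\<^sup>2 * h\<^sup>2 = (z * h / b\<^sup>2)\<^sup>2 * b\<^sup>2"
      using ab by (simp add: power_divide power_mult_distrib field_simps)
    also have "\<dots> = b * (2 * a + b) / (a + b)\<^sup>2 * h\<^sup>2"
      unfolding zh h(2) by (simp add: power_divide) algebra
    finally show ?thesis using h(1) by (subst (asm) mult_right_cancel) auto
  qed
  have "nondegenerate ?T"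
    using ab h(1) by (simp add: nondegenerate_def collinear_iff_cross)
  moreover have "inscribed_in ?T (ellipse (a + b) (a + b))"
    using R h(2) by (simp add: inscribed_in_def ellipse_def add_divide_distrib[symmetric])
      (simp add: algebra_simps power2_eq_square)
  moreover have "inscribed_in ?U (ellipse a b)"
  proof -
    have "(a\<^sup>2 / (a + b))\<^sup>2 / a\<^sup>2 = a\<^sup>2 / (a + b)\<^sup>2"
      using ab by (simp add: power_divide power2_eq_square)
    moreover have "a\<^sup>2 + b * (2 * a + b) = (a + b)\<^sup>2" by (simp add: algebra_simps power2_eq_square)
    ultimately have "(a\<^sup>2 / (a + b))\<^sup>2 / a\<^sup>2 + z\<^sup>2 / b\<^sup>2 = (a + b)\<^sup>2 / (a + b)\<^sup>2"
      unfolding zz by (simp only: add_divide_distrib[symmetric])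
    also have "\<dots> = 1" using R by simp
    finally have "(a\<^sup>2 / (a + b))\<^sup>2 / a\<^sup>2 + z\<^sup>2 / b\<^sup>2 = 1" .
    then show ?thesis using ab by (simp add: inscribed_in_def ellipse_def)
  qed
  moreover have "polar_dual a b ?T ?U"
  proof -
    have "- a / (a + b) + z * h / b\<^sup>2 = 1"
      using R unfolding zh by (simp add: diff_divide_distrib[symmetric])
    then show ?thesis
      using ab R by (simp add: polar_dual_def polar_form_def power2_eq_square)
  qed
  ultimately have "?T \<in> circumcircle_family a b"
    unfolding circumcircle_family_eq[OF ab] poncelet_triangles_ellipse[OF ab] by blast
  then show ?thesis by blast
qed

text \<open>
  The confocal family is the one of triangles inscribed in \<open>ellipse p q\<close> and circumscribed about
  \<open>ellipse \<alpha> \<beta>\<close>, whose common foci are \<open>(- c, 0)\<close> and \<open>(c, 0)\<close> with \<open>c\<^sup>2 = p\<^sup>2 - q\<^sup>2\<close>.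
\<close>
lemma excentral_family_confocal_ellipses:
  assumes "q > 0" "q \<le> p" "\<alpha> > 0" "\<beta> > 0" and conf: "p\<^sup>2 - \<alpha>\<^sup>2 = q\<^sup>2 - \<beta>\<^sup>2" and "\<alpha> < p"
    and ne: "poncelet_triangles (ellipse (p\<^sup>2 / \<alpha>) (q\<^sup>2 / \<beta>)) (ellipse p q) \<noteq> {}"
  shows "excentral_family (poncelet_triangles (ellipse (p\<^sup>2 / \<alpha>) (q\<^sup>2 / \<beta>)) (ellipse p q))"
proof -
  have pos: "p > 0" "q > 0" "\<alpha> > 0" "\<beta> > 0" using assms by auto
  define c where "c = sqrt (p\<^sup>2 - q\<^sup>2)"
  have c2: "c\<^sup>2 = p\<^sup>2 - q\<^sup>2" using assms by (simp add: c_def)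
  have c0: "c \<ge> 0" using assms by (simp add: c_def)
  have "c\<^sup>2 < \<alpha>\<^sup>2" using c2 conf pos by (smt (verit) zero_less_power)
  then have ca: "c < \<alpha>" using pos by (simp add: power_less_imp_less_base)
  have "\<alpha>\<^sup>2 - c\<^sup>2 = \<beta>\<^sup>2" "p\<^sup>2 - c\<^sup>2 = q\<^sup>2" using c2 conf by simp_all
  then have F: "focal_ellipse (- c, 0) (c, 0) p = ellipse p q"
    "focal_ellipse (- c, 0) (c, 0) \<alpha> = ellipse \<alpha> \<beta>"
    using focal_ellipse_eq[OF c0] ca assms(6) pos by auto
  define \<F> where "\<F> = poncelet_triangles (ellipse p q) (ellipse \<alpha> \<beta>)"
  have eq: "{T'. \<exists>T\<in>\<F>. excentral_of T T'} =
    poncelet_triangles (ellipse (p\<^sup>2 / \<alpha>) (q\<^sup>2 / \<beta>)) (ellipse p q)"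
    unfolding poncelet_triangles_polar_dual[OF pos, symmetric] \<F>_def
    using excentral_iff_polar_dual[OF pos conf] by blast
  moreover have "confocal_family \<F>"
    unfolding confocal_family_def
  proof (intro exI conjI)
    show "dist (- c, 0) (c, 0 :: real) < 2 * \<alpha>"
      using c0 ca by (simp add: dist_prod_def dist_real_def real_sqrt_mult)
    show "\<alpha> < p" by fact
    show "\<F> = poncelet_triangles (focal_ellipse (- c, 0) (c, 0) p) (focal_ellipse (- c, 0) (c, 0) \<alpha>)"
      by (simp add: \<F>_def F)
    show "\<F> \<noteq> {}" using ne eq by auto
  qed
  ultimately show ?thesis unfolding excentral_family_def by blast
qed

text \<open>
  Confocality of the ellipses with semi-axes \<open>s a, b\<close> and \<open>s a\<^sup>2 / R, b\<^sup>2 / R\<close> reads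
  \<open>s\<^sup>2 a\<^sup>2 (R\<^sup>2 - a\<^sup>2) = b\<^sup>2 (R\<^sup>2 - b\<^sup>2)\<close>, which for \<open>R = a + b\<close> determines \<open>s\<^sup>2\<close> as stated.
\<close>
lemma excentral_family_scaled_circumcircle_family:
  assumes ab: "a \<ge> b" "b > 0" and s: "s > 0" "s\<^sup>2 = b * (a + 2 * b) / (a * (b + 2 * a))"
  shows "excentral_family (scale_tri s ` circumcircle_family a b)"
proof -
  have a: "a > 0" using ab by simp
  define \<alpha> \<beta> where "\<alpha> = s * a\<^sup>2 / (a + b)" and "\<beta> = b\<^sup>2 / (a + b)"
  have s2: "s\<^sup>2 * (a * (b + 2 * a)) = b * (a + 2 * b)" unfolding s(2) using a ab by simp
  have O: "(s * a)\<^sup>2 / \<alpha> = s * (a + b)" "b\<^sup>2 / \<beta> = a + b"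
    using a ab s(1) by (simp_all add: \<alpha>_def \<beta>_def power2_eq_square)
  have eq: "scale_tri s ` circumcircle_family a b =
    poncelet_triangles (ellipse ((s * a)\<^sup>2 / \<alpha>) (b\<^sup>2 / \<beta>)) (ellipse (s * a) b)"
    unfolding O circumcircle_family_eq[OF a ab(2)] by (rule scale_tri_poncelet[OF s(1) a ab(2)])
  show ?thesis
    unfolding eq
  proof (rule excentral_family_confocal_ellipses)
    show "b > 0" "\<alpha> > 0" "\<beta> > 0" using a ab s by (simp_all add: \<alpha>_def \<beta>_def)
    have "b\<^sup>2 * (b + 2 * a) \<le> s\<^sup>2 * a\<^sup>2 * (b + 2 * a)"
    proof -
      have "s\<^sup>2 * a\<^sup>2 * (b + 2 * a) - b\<^sup>2 * (b + 2 * a) = b * (a + b) * (a - b)"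
        using s2 by algebra
      moreover have "b * (a + b) * (a - b) \<ge> 0" using ab by simp
      ultimately show ?thesis by simp
    qed
    then have "b\<^sup>2 \<le> (s * a)\<^sup>2" using a ab by (simp add: power_mult_distrib)
    then show "b \<le> s * a" using s(1) a by (auto intro: power2_le_imp_le)
    have "s * a\<^sup>2 < s * a * (a + b)"
      using a ab(2) s(1) by (simp add: power2_eq_square distrib_left)
    then show "\<alpha> < s * a" using a ab(2) by (simp add: \<alpha>_def divide_less_eq)
    have clear: "(a + b)\<^sup>2 * (u / (a + b))\<^sup>2 = u\<^sup>2" for u
      using a ab(2) by (simp flip: power_mult_distrib)
    have "(a + b)\<^sup>2 * ((s * a)\<^sup>2 - \<alpha>\<^sup>2) = (s * a)\<^sup>2 * ((a + b)\<^sup>2 - a\<^sup>2)"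
      unfolding right_diff_distrib \<alpha>_def clear by algebra
    also have "\<dots> = b\<^sup>2 * ((a + b)\<^sup>2 - b\<^sup>2)" using s2 by algebra
    also have "\<dots> = (a + b)\<^sup>2 * (b\<^sup>2 - \<beta>\<^sup>2)"
      unfolding right_diff_distrib \<beta>_def clear by algebra
    finally show "(s * a)\<^sup>2 - \<alpha>\<^sup>2 = b\<^sup>2 - \<beta>\<^sup>2" using a ab(2) by simp
    show "poncelet_triangles (ellipse ((s * a)\<^sup>2 / \<alpha>) (b\<^sup>2 / \<beta>)) (ellipse (s * a) b) \<noteq> {}"
      using circumcircle_family_nonempty[OF a ab(2)] unfolding eq[symmetric] by simp
  qed
qed

theorem proposition2:
  fixes a b s' :: real
  assumes "a \<ge> b" and "b > 0"
    and "s' = sqrt ((2 * b\<^sup>2 + a * b) / (2 * a\<^sup>2 + a * b))"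
  shows "(\<forall>T \<in> circumcircle_family a b. cos_product T = a * b / (2 * (a + b)\<^sup>2)) \<and>
    (\<forall>T \<in> scale_tri s' ` circumcircle_family a b. cos_product T = a * b / (2 * (a + b)\<^sup>2)) \<and>
    excentral_family (scale_tri s' ` circumcircle_family a b)"
proof -
  have a: "a > 0" using assms(1,2) by simp
  have "(2 * b\<^sup>2 + a * b) / (2 * a\<^sup>2 + a * b) = b * (a + 2 * b) / (a * (b + 2 * a))"
    by (simp add: algebra_simps power2_eq_square)
  moreover have "b * (a + 2 * b) / (a * (b + 2 * a)) > 0" using a assms(2) by simp
  ultimately have s: "s' > 0" "s'\<^sup>2 = b * (a + 2 * b) / (a * (b + 2 * a))"
    using assms(3) by simp_all
  have "cos_product T = a * b / (2 * (a + b)\<^sup>2)" if "T \<in> circumcircle_family a b" for T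
    using cos_product_scaled_circumcircle_family[OF a assms(2) that, of 1] by (simp add: scale_tri_one)
  moreover have "cos_product (scale_tri s' T) = a * b / (2 * (a + b)\<^sup>2)"
    if "T \<in> circumcircle_family a b" for T
    using cos_product_scaled_circumcircle_family[OF a assms(2) that s(1)] s(2) by blast
  ultimately show ?thesis
    using excentral_family_scaled_circumcircle_family[OF assms(1,2) s] by blast
qed

end
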